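(* Let $m$ be a positive integer, let $H$ be a nonempty finite set of nonnegative integers, and let $G$ be an additive abelian group. Then $$\rho_{\pm}(G, m, H) = \min \{|H_{\pm}A| : A \in \mathcal{A}(G, m)\}.$$
   Context: For a nonempty finite subset $A=\{a_1,\dots,a_k\}$ (with $|A|=k$) of an additive abelian group $G$ and a nonnegative integer $h$, the $h$-fold signed sumset is $h_{\pm}A=\{\sum_{i=1}^k\lambda_i a_i:\lambda_i\in\mathbb{Z}\cap[-h,h],\ \sum_{i=1}^k|\lambda_i|=h\}$, with $0_{\pm}A=\{0\}$. For a nonempty finite set $H$ of nonnegative integers, $H_{\pm}A=\bigcup_{h\in H}h_{\pm}A$. Write $-A=\{-a:a\in A\}$. Define $\mathrm{Sym}(G,m)=\{A\subseteq G: A=-A,\ |A|=m\}$; $\mathrm{Asym}(G,m)=\{A\subseteq G: A\cap(-A)=\varnothing,\ |A|=m\}$; $\mathrm{Nsym}(G,m)=\{A\subseteq G: |A|=m,\ A\notin\mathrm{Sym}(G,m),\ A\setminus\{a\}\in\mathrm{Sym}(G,m-1)\text{ for some }a\in A\}$; $\mathcal{A}(G,m)=\mathrm{Asym}(G,m)\cup\mathrm{Sym}(G,m)\cup\mathrm{Nsym}(G,m)$; $\rho_{\pm}(G,m,H)=\min\{|H_{\pm}A|:A\subseteq G,\ |A|=m\}$. The group $G$ need not be finite. Minima are understood to be taken over nonempty families, i.e. $G$ has at least $m$ elements. *)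

theory Defs
  imports "HOL-Algebra.Ring"
begin

text \<open>
  Additive abelian groups are instances of \<^locale>\<open>abelian_group\<close>; only the carrier, zero and
  addition of the underlying ring record are used.
\<close>

definition signed_sumset :: "('a, 'b) ring_scheme \<Rightarrow> nat \<Rightarrow> 'a set \<Rightarrow> 'a set" where
  "signed_sumset G h A =
     {(\<Oplus>\<^bsub>G\<^esub>a\<in>A. [c a] \<cdot>\<^bsub>G\<^esub> a) | c :: 'a \<Rightarrow> int.
        (\<forall>a\<in>A. c a \<in> {- int h..int h}) \<and> (\<Sum>a\<in>A. \<bar>c a\<bar>) = int h}"

definition signed_sumset_set :: "('a, 'b) ring_scheme \<Rightarrow> nat set \<Rightarrow> 'a set \<Rightarrow> 'a set" where
  "signed_sumset_set G H A = (\<Union>h\<in>H. signed_sumset G h A)"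

definition subsets_of_size :: "('a, 'b) ring_scheme \<Rightarrow> nat \<Rightarrow> 'a set set" where
  "subsets_of_size G m = {A. A \<subseteq> carrier G \<and> finite A \<and> card A = m}"

definition Sym :: "('a, 'b) ring_scheme \<Rightarrow> nat \<Rightarrow> 'a set set" where
  "Sym G m = {A \<in> subsets_of_size G m. A = a_inv G ` A}"

definition Asym :: "('a, 'b) ring_scheme \<Rightarrow> nat \<Rightarrow> 'a set set" where
  "Asym G m = {A \<in> subsets_of_size G m. A \<inter> a_inv G ` A = {}}"

text \<open>
  For \<^prop>\<open>m > 0\<close> the truncated subtraction \<^term>\<open>m - 1 :: nat\<close> is the usual one; for
  \<^prop>\<open>m = 0\<close> there is no \<^prop>\<open>a \<in> A\<close> to remove.
\<close>

definition Nsym :: "('a, 'b) ring_scheme \<Rightarrow> nat \<Rightarrow> 'a set set" where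
  "Nsym G m =
     {A \<in> subsets_of_size G m. A \<notin> Sym G m \<and> (\<exists>a\<in>A. A - {a} \<in> Sym G (m - 1))}"

definition sym_family :: "('a, 'b) ring_scheme \<Rightarrow> nat \<Rightarrow> 'a set set" where
  "sym_family G m = Asym G m \<union> Sym G m \<union> Nsym G m"

text \<open>
  On natural numbers, the infimum of a nonempty set is its minimum, also when the set is not known
  to be finite (\<^const>\<open>Min\<close> is only meaningful on finite sets).  The cardinalities below
  are genuine, since signed sumsets of a finite set for a finite \<open>H\<close> are finite.
\<close>

definition rho_signed :: "('a, 'b) ring_scheme \<Rightarrow> nat \<Rightarrow> nat set \<Rightarrow> nat" where
  "rho_signed G m H = (INF A \<in> subsets_of_size G m. card (signed_sumset_set G H A))"

end

theory Submission
  imports Defs "HOL-Algebra.AbelCoset"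
begin

text \<open>
  Let \<open>B = A \<union> -A\<close>.  A signed sum of weight \<open>h\<close> over \<open>A\<close> is a sum of \<open>h\<close> terms \<open>\<plusminus>a\<close> with \<open>a \<in> A\<close>
  in which each \<open>a\<close> is used with one sign only, so \<open>h\<^sub>\<plusminus>A\<close> is contained in the \<open>h\<close>-fold sumset of \<open>B\<close>.  If \<open>A\<close> contains some \<open>s\<close> together with \<open>-s\<close>, then equality holds
  (\<open>signed_sumset_eq_nfold_sumset\<close>): every cancellation lowers the weight by an even number, and the
  missing weight can be spent on \<open>s\<close> and \<open>-s\<close> without changing the value
  (\<open>signed_sumset_add_two\<close>).

  Consequently, if \<open>A\<close> contains such an \<open>s\<close>, then \<open>h\<^sub>\<plusminus>A' \<subseteq> h\<^sub>\<plusminus>A\<close> for every finite \<open>A' \<subseteq> A \<union> -A\<close> and all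
  \<open>h\<close> simultaneously.  There is such an \<open>A'\<close> of the same size as \<open>A\<close> that is symmetric, or symmetric
  up to one element: among the elements of \<open>A\<close> whose negative is missing, half are exchanged for
  the negatives of the other half (\<open>symmetrization\<close>).  A set \<open>A\<close> without such an \<open>s\<close> is
  asymmetric.  So every set of size \<open>m\<close> can be replaced by one in the smaller family whose signed
  sumsets are no larger.
\<close>

section \<open>Signed sums and iterated sumsets\<close>

lemma signed_sumset_iff:
  assumes "finite A"
  shows "x \<in> signed_sumset G h A \<longleftrightarrow>
    (\<exists>c :: 'a \<Rightarrow> int. x = (\<Oplus>\<^bsub>G\<^esub>a\<in>A. [c a] \<cdot>\<^bsub>G\<^esub> a) \<and> (\<Sum>a\<in>A. \<bar>c a\<bar>) = int h)"
proof -
  have "c a \<in> {- int h..int h}"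
    if "(\<Sum>a\<in>A. \<bar>c a\<bar>) = int h" "a \<in> A" for c :: "'a \<Rightarrow> int" and a
    using member_le_sum[OF that(2), of "\<lambda>a. \<bar>c a\<bar>"] assms that(1) by auto
  then show ?thesis
    unfolding signed_sumset_def by blast
qed

primrec nfold_sumset :: "('a, 'b) ring_scheme \<Rightarrow> 'a set \<Rightarrow> nat \<Rightarrow> 'a set" where
  "nfold_sumset G B 0 = {\<zero>\<^bsub>G\<^esub>}"
| "nfold_sumset G B (Suc n) = nfold_sumset G B n <+>\<^bsub>G\<^esub> B"

lemma nfold_sumset_SucI:
  "x \<in> nfold_sumset G B n \<Longrightarrow> b \<in> B \<Longrightarrow> x \<oplus>\<^bsub>G\<^esub> b \<in> nfold_sumset G B (Suc n)"
  by (auto simp: set_add_def set_mult_def)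

lemma nfold_sumset_mono:
  assumes "B \<subseteq> C"
  shows "nfold_sumset G B n \<subseteq> nfold_sumset G C n"
proof (induction n)
  case (Suc n)
  then show ?case
    using assms by (auto simp: set_add_def set_mult_def)
qed simp

context abelian_group
begin

lemma zero_add_pow: "[(0 :: int)] \<cdot> x = \<zero>"
  by (simp add: add_pow_def)

lemma weighted_sum_update:
  fixes c :: "'a \<Rightarrow> int"
  assumes "finite A" "A \<subseteq> carrier G" "a \<in> A"
  shows "(\<Oplus>x\<in>A. [(c(a := c a + k)) x] \<cdot> x) = (\<Oplus>x\<in>A. [c x] \<cdot> x) \<oplus> [k] \<cdot> a"
proof -
  have a: "a \<in> carrier G"
    using assms by auto
  have A: "A = insert a (A - {a})"
    using assms by auto
  have split: "(\<Oplus>x\<in>A. [d x] \<cdot> x) = [d a] \<cdot> a \<oplus> (\<Oplus>x\<in>A - {a}. [d x] \<cdot> x)" for d :: "'a \<Rightarrow> int"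
    using assms a by (subst A, subst finsum_insert) auto
  have rest: "(\<Oplus>x\<in>A - {a}. [(c(a := c a + k)) x] \<cdot> x) = (\<Oplus>x\<in>A - {a}. [c x] \<cdot> x)"
    using assms by (intro finsum_cong') auto
  have "(\<Oplus>x\<in>A - {a}. [c x] \<cdot> x) \<in> carrier G"
    using assms by (intro finsum_closed) auto
  moreover have "[(c a + k)] \<cdot> a = [c a] \<cdot> a \<oplus> [k] \<cdot> a"
    using add.int_pow_mult[OF a] by simp
  ultimately show ?thesis
    unfolding split[of "c(a := c a + k)"] split[of c] rest
    using a by (simp add: a_ac)
qed

lemma weight_update:
  fixes c :: "'a \<Rightarrow> int"
  assumes "finite A" "a \<in> A"
  shows "(\<Sum>x\<in>A. \<bar>(c(a := v)) x\<bar>) = (\<Sum>x\<in>A. \<bar>c x\<bar>) - \<bar>c a\<bar> + \<bar>v\<bar>"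
proof -
  have "(\<Sum>x\<in>A - {a}. \<bar>(c(a := v)) x\<bar>) = (\<Sum>x\<in>A - {a}. \<bar>c x\<bar>)"
    by (rule sum.cong) auto
  then show ?thesis
    using sum.remove[OF assms, of "\<lambda>x. \<bar>c x\<bar>"] sum.remove[OF assms, of "\<lambda>x. \<bar>(c(a := v)) x\<bar>"]
    by simp
qed

lemma signed_sumset_subset_nfold_sumset:
  assumes "finite A" "A \<subseteq> carrier G"
  shows "signed_sumset G h A \<subseteq> nfold_sumset G (A \<union> a_inv G ` A) h"
proof (induction h)
  case 0
  show ?case
  proof
    fix x
    assume "x \<in> signed_sumset G 0 A"
    then obtain c :: "'a \<Rightarrow> int" where x: "x = (\<Oplus>a\<in>A. [c a] \<cdot> a)" and "(\<Sum>a\<in>A. \<bar>c a\<bar>) = 0"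
      by (auto simp: signed_sumset_iff[OF assms(1)])
    then have "c a = 0" if "a \<in> A" for a
      using that assms(1) by (simp add: sum_nonneg_eq_0_iff)
    then have "x = (\<Oplus>a\<in>A. \<zero>)"
      unfolding x using assms(2) by (intro finsum_cong') (auto simp: zero_add_pow)
    then show "x \<in> nfold_sumset G (A \<union> a_inv G ` A) 0"
      by simp
  qed
next
  case (Suc h)
  show ?case
  proof
    fix x
    assume "x \<in> signed_sumset G (Suc h) A"
    then obtain c :: "'a \<Rightarrow> int" where x: "x = (\<Oplus>a\<in>A. [c a] \<cdot> a)"
      and wt: "(\<Sum>a\<in>A. \<bar>c a\<bar>) = int (Suc h)"
      by (auto simp: signed_sumset_iff[OF assms(1)])
    obtain a where a: "a \<in> A" "c a \<noteq> 0"
      using wt by (metis abs_zero of_nat_0_eq_iff old.nat.distinct(1) sum.neutral)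
    then have ac: "a \<in> carrier G"
      using assms(2) by auto
    define k :: int where "k = - sgn (c a)"
    define y where "y = (\<Oplus>x\<in>A. [(c(a := c a + k)) x] \<cdot> x)"
    have "\<bar>c a + k\<bar> = \<bar>c a\<bar> - 1"
      using a(2) unfolding k_def by (auto simp: sgn_if)
    then have "(\<Sum>x\<in>A. \<bar>(c(a := c a + k)) x\<bar>) = int h"
      using weight_update[OF assms(1) a(1), of c "c a + k"] wt by simp
    then have "y \<in> signed_sumset G h A"
      using signed_sumset_iff[OF assms(1)] unfolding y_def by blast
    then have y: "y \<in> nfold_sumset G (A \<union> a_inv G ` A) h"
      using Suc by auto
    have xc: "x \<in> carrier G"
      unfolding x using assms(2) by (intro finsum_closed) auto
    have k: "k = 1 \<or> k = - 1"
      using a(2) unfolding k_def by (auto simp: sgn_if)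
    have yx: "y = x \<oplus> [k] \<cdot> a"
      unfolding y_def x by (rule weighted_sum_update[OF assms a(1)])
    have "x = y \<oplus> \<ominus> ([k] \<cdot> a)"
      unfolding yx using xc ac by (simp add: a_assoc r_neg)
    moreover have "\<ominus> ([k] \<cdot> a) \<in> A \<union> a_inv G ` A"
      using k a ac by (auto simp: add.int_pow_neg)
    ultimately show "x \<in> nfold_sumset G (A \<union> a_inv G ` A) (Suc h)"
      using y by (simp only: nfold_sumset_SucI)
  qed
qed

section \<open>Absorbing cancellation in a pair of opposite elements\<close>

text \<open>
  For \<open>s \<noteq> -s\<close>, adding the same \<open>k\<close> to the coefficients of \<open>s\<close> and \<open>-s\<close> does not change the sum; a
  suitable \<open>k\<close> raises the weight by exactly two.  For \<open>s = -s\<close> the coefficient of \<open>s\<close> matters only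
  modulo two.
\<close>

lemma signed_sumset_add_two:
  assumes "finite A" "A \<subseteq> carrier G" "s \<in> A" "\<ominus> s \<in> A"
  shows "signed_sumset G h A \<subseteq> signed_sumset G (h + 2) A"
proof
  fix x
  assume "x \<in> signed_sumset G h A"
  then obtain c :: "'a \<Rightarrow> int" where x: "x = (\<Oplus>a\<in>A. [c a] \<cdot> a)"
    and wt: "(\<Sum>a\<in>A. \<bar>c a\<bar>) = int h"
    by (auto simp: signed_sumset_iff[OF assms(1)])
  have xc: "x \<in> carrier G"
    unfolding x using assms(2) by (intro finsum_closed) auto
  have s: "s \<in> carrier G"
    using assms by auto
  show "x \<in> signed_sumset G (h + 2) A"
  proof (cases "\<ominus> s = s")
    case True
    define k :: int where "k = (if c s \<ge> 0 then 2 else - 2)"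
    have two: "[(2 :: int)] \<cdot> s = \<zero>"
      using add.int_pow_mult[OF s, of 1 1] r_neg[OF s] s True by simp
    then have "[k] \<cdot> s = \<zero>"
      using s add.int_pow_neg[OF s, of 2] by (simp add: k_def)
    then have "(\<Oplus>a\<in>A. [(c(s := c s + k)) a] \<cdot> a) = x"
      using weighted_sum_update[OF assms(1-3), of c k] xc x by simp
    moreover have "(\<Sum>a\<in>A. \<bar>(c(s := c s + k)) a\<bar>) = int (h + 2)"
      using weight_update[OF assms(1,3), of c "c s + k"] wt by (auto simp: k_def)
    ultimately show ?thesis
      using signed_sumset_iff[OF assms(1)] by metis
  next
    case False
    obtain k where k: "\<bar>c s + k\<bar> + \<bar>c (\<ominus> s) + k\<bar> = \<bar>c s\<bar> + \<bar>c (\<ominus> s)\<bar> + 2"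
    proof -
      define p q where "p = c s" and "q = c (\<ominus> s)"
      \<comment> \<open>For opposite signs, the shift makes the negative coefficient equal to one.\<close>
      define k where "k = (if p \<ge> 0 \<and> q \<ge> 0 then 1 else if p \<le> 0 \<and> q \<le> 0 then - 1
        else 1 - min p q)"
      have "\<bar>p + k\<bar> + \<bar>q + k\<bar> = \<bar>p\<bar> + \<bar>q\<bar> + 2"
        unfolding k_def by (auto simp: min_def)
      then show ?thesis
        using that unfolding p_def q_def by blast
    qed
    define d where "d = c(s := c s + k)"
    define e where "e = d(\<ominus> s := d (\<ominus> s) + k)"
    have d: "d (\<ominus> s) = c (\<ominus> s)"
      using False by (simp add: d_def)
    have "(\<Oplus>a\<in>A. [e a] \<cdot> a) = (x \<oplus> [k] \<cdot> s) \<oplus> [k] \<cdot> (\<ominus> s)"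
      unfolding e_def weighted_sum_update[OF assms(1,2,4)]
      unfolding d_def weighted_sum_update[OF assms(1,2,3)] x ..
    also have "\<dots> = x"
      using s xc add.int_pow_inv[OF s, of k] by (simp add: a_assoc r_neg)
    finally have "(\<Oplus>a\<in>A. [e a] \<cdot> a) = x" .
    moreover have "(\<Sum>a\<in>A. \<bar>e a\<bar>) = int (h + 2)"
      unfolding e_def weight_update[OF assms(1,4)]
      using weight_update[OF assms(1,3), of c "c s + k", folded d_def] wt k d by simp
    ultimately show ?thesis
      using signed_sumset_iff[OF assms(1)] by metis
  qed
qed

text \<open>
  Adding an element of \<open>A \<union> -A\<close> moves one coefficient by one, so the weight goes up by one or down by
  one; in the second case the pair \<open>s\<close>, \<open>-s\<close> makes up for the difference.
\<close>

lemma nfold_sumset_subset_signed_sumset: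
  assumes "finite A" "A \<subseteq> carrier G" "s \<in> A" "\<ominus> s \<in> A"
  shows "nfold_sumset G (A \<union> a_inv G ` A) h \<subseteq> signed_sumset G h A"
proof (induction h)
  case 0
  have "\<zero> = (\<Oplus>a\<in>A. [(0 :: int)] \<cdot> a) \<and> (\<Sum>a\<in>A. \<bar>0 :: int\<bar>) = int 0"
    by (simp add: zero_add_pow)
  then have "\<zero> \<in> signed_sumset G 0 A"
    unfolding signed_sumset_iff[OF assms(1)] by (intro exI[of _ "\<lambda>_. 0"])
  then show ?case
    by simp
next
  case (Suc h)
  show ?case
  proof
    fix z
    assume "z \<in> nfold_sumset G (A \<union> a_inv G ` A) (Suc h)"
    then obtain x b where z: "z = x \<oplus> b" and b: "b \<in> A \<union> a_inv G ` A"
      and "x \<in> nfold_sumset G (A \<union> a_inv G ` A) h"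
      by (auto simp: set_add_def set_mult_def)
    then obtain c :: "'a \<Rightarrow> int" where x: "x = (\<Oplus>a\<in>A. [c a] \<cdot> a)"
      and wt: "(\<Sum>a\<in>A. \<bar>c a\<bar>) = int h"
      using Suc signed_sumset_iff[OF assms(1)] by blast
    obtain a k where a: "a \<in> A" and k: "k = 1 \<or> k = (- 1 :: int)" and "b = [k] \<cdot> a"
    proof (cases "b \<in> A")
      case True
      then show ?thesis
        using that[of b 1] assms(2) by auto
    next
      case False
      then obtain a where "a \<in> A" "b = \<ominus> a"
        using b by auto
      then show ?thesis
        using that[of a "- 1"] assms(2) by (auto simp: add.int_pow_neg)
    qed
    then have sum: "z = (\<Oplus>x\<in>A. [(c(a := c a + k)) x] \<cdot> x)"
      unfolding z x using weighted_sum_update[OF assms(1,2) a] by simp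
    have wt': "(\<Sum>x\<in>A. \<bar>(c(a := c a + k)) x\<bar>) = int h - \<bar>c a\<bar> + \<bar>c a + k\<bar>"
      using weight_update[OF assms(1) a] wt by simp
    have "\<bar>c a\<bar> \<le> int h"
      using member_le_sum[OF a, of "\<lambda>a. \<bar>c a\<bar>"] assms(1) wt by simp
    then consider "\<bar>c a + k\<bar> = \<bar>c a\<bar> + 1" | "\<bar>c a + k\<bar> = \<bar>c a\<bar> - 1" "h \<ge> 1"
      using k by linarith
    then show "z \<in> signed_sumset G (Suc h) A"
    proof cases
      case 1
      then show ?thesis
        using wt' sum unfolding signed_sumset_iff[OF assms(1)]
        by (intro exI[of _ "c(a := c a + k)"]) simp
    next
      case 2
      then have "z \<in> signed_sumset G (h - 1) A"
        using wt' sum unfolding signed_sumset_iff[OF assms(1)]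
        by (intro exI[of _ "c(a := c a + k)"]) (simp add: of_nat_diff)
      then show ?thesis
        using signed_sumset_add_two[OF assms, of "h - 1"] 2(2) by auto
    qed
  qed
qed

lemma signed_sumset_eq_nfold_sumset:
  assumes "finite A" "A \<subseteq> carrier G" "s \<in> A" "\<ominus> s \<in> A"
  shows "signed_sumset G h A = nfold_sumset G (A \<union> a_inv G ` A) h"
  using signed_sumset_subset_nfold_sumset[OF assms(1,2)] nfold_sumset_subset_signed_sumset[OF assms]
  by (rule equalityI)

lemma finite_signed_sumset:
  assumes "finite A" "A \<subseteq> carrier G"
  shows "finite (signed_sumset G h A)"
proof -
  have "finite (nfold_sumset G (A \<union> a_inv G ` A) h)"
    by (induction h) (use assms(1) in \<open>auto simp: set_add_def set_mult_def\<close>)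
  then show ?thesis
    using signed_sumset_subset_nfold_sumset[OF assms] by (rule rev_finite_subset)
qed

section \<open>Making a set symmetric\<close>

text \<open>
  The asymmetric part \<open>N\<close> of \<open>A\<close> is replaced by \<open>N' \<union> -N'\<close>, where \<open>N'\<close> consists of half of its elements,
  rounded down;
  if \<open>N\<close> has odd size, one further element of \<open>N\<close> is kept.
\<close>

lemma symmetrization:
  assumes "A \<in> subsets_of_size G m"
  obtains A' where "A' \<in> Sym G m \<union> Nsym G m" "A' \<subseteq> A \<union> a_inv G ` A"
proof -
  have A: "A \<subseteq> carrier G" "finite A" "card A = m"
    using assms by (auto simp: subsets_of_size_def)
  define S where "S = {a \<in> A. \<ominus> a \<in> A}"
  define N where "N = {a \<in> A. \<ominus> a \<notin> A}"
  have SN: "A = S \<union> N" "S \<inter> N = {}" and fin: "finite S" "finite N"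
    using A by (auto simp: S_def N_def)
  then have cardA: "m = card S + card N"
    using A(3) card_Un_disjoint by blast
  obtain N' where N': "N' \<subseteq> N" "card N' = card N div 2" "finite N'"
    using obtain_subset_with_card_n[of "card N div 2" N] by auto
  have inj: "inj_on (a_inv G) N'"
    using A(1) N'(1) by (intro inj_onI) (metis (lifting) N_def mem_Collect_eq minus_minus subsetD)
  define C where "C = S \<union> (N' \<union> a_inv G ` N')"
  have Cc: "C \<subseteq> carrier G" and Cfin: "finite C" and CB: "C \<subseteq> A \<union> a_inv G ` A"
    using A(1) N' fin SN(1) by (auto simp: C_def)
  have "N' \<inter> a_inv G ` N' = {}" "S \<inter> (N' \<union> a_inv G ` N') = {}"
    using N'(1) by (auto simp: S_def N_def)
  then have cardC: "card C = card S + 2 * (card N div 2)"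
    using fin N' inj by (simp add: C_def card_Un_disjoint card_image)
  have "\<ominus> x \<in> C" if "x \<in> C" for x
    using that A(1) N'(1) by (auto simp: C_def S_def N_def)
  moreover from this have "x \<in> a_inv G ` C" if "x \<in> C" for x
    using that Cc by (intro image_eqI[of _ _ "\<ominus> x"]) auto
  ultimately have Csym: "C = a_inv G ` C"
    by auto
  have CSym: "C \<in> Sym G (card C)"
    using Cc Cfin Csym by (simp add: Sym_def subsets_of_size_def)
  show ?thesis
  proof (cases "even (card N)")
    case True
    then have "card C = m"
      using cardA cardC by simp
    then show ?thesis
      using that[of C] CSym CB by auto
  next
    case False
    then have "card N' < card N"
      using N'(2) by (cases "card N") auto
    then obtain b where b: "b \<in> N" "b \<notin> N'"
      using N' by (metis subsetI subset_antisym nat_neq_iff)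
    then have bA: "b \<in> A" "\<ominus> b \<notin> A" "b \<in> carrier G"
      using A(1) by (auto simp: N_def)
    have bC: "b \<notin> C"
      using b bA A(1) N'(1) by (auto simp: C_def S_def N_def)
    have card: "card (insert b C) = m"
      using False cardA cardC bC Cfin by simp
    have "\<ominus> b \<notin> insert b C"
      using bA bC Csym by (metis image_eqI insertE minus_minus)
    then have "insert b C \<notin> Sym G m"
      by (auto simp: Sym_def)
    moreover have "insert b C - {b} \<in> Sym G (m - 1)"
      using CSym bC card Cfin by auto
    moreover have "insert b C \<in> subsets_of_size G m"
      using card Cfin Cc bA by (simp add: subsets_of_size_def)
    ultimately have "insert b C \<in> Nsym G m"
      by (auto simp: Nsym_def)
    then show ?thesis
      using that[of "insert b C"] CB bA by auto
  qed
qed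

lemma ex_sym_family_signed_sumset_subset:
  assumes "A \<in> subsets_of_size G m"
  obtains A' where "A' \<in> sym_family G m" "\<And>h. signed_sumset G h A' \<subseteq> signed_sumset G h A"
proof (cases "\<exists>s\<in>A. \<ominus> s \<in> A")
  case True
  have A: "A \<subseteq> carrier G" "finite A"
    using assms by (auto simp: subsets_of_size_def)
  from True obtain s where s: "s \<in> A" "\<ominus> s \<in> A"
    by auto
  obtain A' where A': "A' \<in> Sym G m \<union> Nsym G m" "A' \<subseteq> A \<union> a_inv G ` A"
    using symmetrization[OF assms] by metis
  have A'c: "A' \<subseteq> carrier G" "finite A'"
    using A'(1) by (auto simp: Sym_def Nsym_def subsets_of_size_def)
  have "a_inv G ` A' \<subseteq> A \<union> a_inv G ` A"
    using A'(2) A(1) by fastforce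
  then have "A' \<union> a_inv G ` A' \<subseteq> A \<union> a_inv G ` A"
    using A'(2) by simp
  then have "nfold_sumset G (A' \<union> a_inv G ` A') h \<subseteq> nfold_sumset G (A \<union> a_inv G ` A) h" for h
    by (rule nfold_sumset_mono)
  then have "signed_sumset G h A' \<subseteq> signed_sumset G h A" for h
    using signed_sumset_subset_nfold_sumset[OF A'c(2,1)]
      signed_sumset_eq_nfold_sumset[OF A(2,1) s] by blast
  then show ?thesis
    using that[of A'] A'(1) by (auto simp: sym_family_def)
next
  case False
  then have "A \<in> Asym G m"
    using assms by (auto simp: Asym_def)
  then show ?thesis
    using that[of A] by (auto simp: sym_family_def)
qed

end

section \<open>The minimum over the symmetric, near-symmetric and asymmetric sets\<close>

theorem theorem1p3:
  fixes G :: "('a, 'b) ring_scheme" and m :: nat and H :: "nat set"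
  assumes "abelian_group G"
    and "m > 0"
    and "finite H" and "H \<noteq> {}"
    and "infinite (carrier G) \<or> m \<le> card (carrier G)"
  shows "rho_signed G m H = (INF A \<in> sym_family G m. card (signed_sumset_set G H A))"
proof -
  interpret abelian_group G by fact
  have sub: "sym_family G m \<subseteq> subsets_of_size G m"
    by (auto simp: sym_family_def Asym_def Sym_def Nsym_def)
  obtain A\<^sub>0 where "A\<^sub>0 \<subseteq> carrier G" "finite A\<^sub>0" "card A\<^sub>0 = m"
    using assms(5) infinite_arbitrarily_large obtain_subset_with_card_n by metis
  then have ne: "subsets_of_size G m \<noteq> {}"
    by (auto simp: subsets_of_size_def)
  then have ne': "sym_family G m \<noteq> {}"
    using ex_sym_family_signed_sumset_subset by blast
  have *: "\<exists>A'\<in>sym_family G m. card (signed_sumset_set G H A') \<le> card (signed_sumset_set G H A)"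
    if A: "A \<in> subsets_of_size G m" for A
  proof -
    obtain A' where A': "A' \<in> sym_family G m" "\<And>h. signed_sumset G h A' \<subseteq> signed_sumset G h A"
      using ex_sym_family_signed_sumset_subset[OF A] by blast
    have "finite (signed_sumset_set G H A)"
      using A assms(3) finite_signed_sumset
      by (auto simp: signed_sumset_set_def subsets_of_size_def)
    moreover have "signed_sumset_set G H A' \<subseteq> signed_sumset_set G H A"
      using A'(2) by (auto simp: signed_sumset_set_def)
    ultimately show ?thesis
      using A'(1) card_mono by blast
  qed
  show ?thesis
    unfolding rho_signed_def
  proof (rule antisym)
    show "(INF A\<in>subsets_of_size G m. card (signed_sumset_set G H A))
        \<le> (INF A\<in>sym_family G m. card (signed_sumset_set G H A))"
      using ne' sub by (intro cINF_superset_mono) auto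
    show "(INF A\<in>sym_family G m. card (signed_sumset_set G H A))
        \<le> (INF A\<in>subsets_of_size G m. card (signed_sumset_set G H A))"
      using ne * by (intro cINF_mono) auto
  qed
qed

end
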